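(* Let $k \geq 2$ be an integer and let $n_1,\ldots,n_k$ be nonnegative integers such that $n_1 \neq 0$ and $n_k \neq 0$. Let \[ m_1 = \sum_{i=1}^{\lceil k/2 \rceil} n_{2i-1} + \lfloor k/2 \rfloor \quad \text{and} \quad m_2 = \sum_{i=1}^{\lfloor k/2 \rfloor} n_{2i} + \lceil k/2 \rceil, \] and let $m=\min\{m_1,m_2\}$. Then \[ r(C(n_1,\ldots,n_k)) \geq \sum_{i=1}^k n_i + k + m - 1 = |V|+m-1, \] where $V$ is the vertex set of $C(n_1,\ldots,n_k)$.
   Context: All graphs are finite, simple and undirected. For a graph $G$, the Ramsey number $r(G)$ is the minimum $r$ such that any $2$-coloring of the edges of the complete graph $K_r$ yields a monochromatic subgraph (not necessarily induced) isomorphic to $G$. $C(n_1,\ldots,n_k)$ denotes the caterpillar with spine $\{v_1,\ldots,v_k\}$, in which $v_1,v_2,\ldots,v_k$ form a path in this order and exactly $n_i$ leaves are attached to (adjacent to) $v_i$ for each $i$; it has no other vertices or edges, so it is a tree with $\sum_{i=1}^k n_i + k$ vertices. *)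

theory Defs
  imports Complex_Main "HOL-Library.Ramsey"
begin

record 'a ugraph =
  verts :: "'a set"
  edges :: "'a set set"

definition simple_graph :: "'a ugraph \<Rightarrow> bool" where
  "simple_graph G \<longleftrightarrow> finite (verts G) \<and> edges G \<subseteq> [verts G]\<^bsup>2\<^esup>"

definition complete_graph :: "nat \<Rightarrow> nat ugraph" where
  "complete_graph r = \<lparr>verts = {..<r}, edges = [{..<r}]\<^bsup>2\<^esup>\<rparr>"

definition is_subgraph :: "'a ugraph \<Rightarrow> 'a ugraph \<Rightarrow> bool" where
  "is_subgraph H K \<longleftrightarrow> simple_graph H \<and> verts H \<subseteq> verts K \<and> edges H \<subseteq> edges K"

definition isomorphic_graphs :: "'a ugraph \<Rightarrow> 'b ugraph \<Rightarrow> bool" where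
  "isomorphic_graphs G H \<longleftrightarrow>
     (\<exists>f. bij_betw f (verts G) (verts H) \<and> edges H = (\<lambda>e. f ` e) ` edges G)"

text \<open>The two colours are the two values of \<^typ>\<open>bool\<close>. A colouring is a total function on sets
  of vertices, but only its values on the edges of the complete graph matter.\<close>

definition arrows :: "nat \<Rightarrow> 'a ugraph \<Rightarrow> bool" where
  "arrows r G \<longleftrightarrow>
     (\<forall>col :: nat set \<Rightarrow> bool. \<exists>H c. is_subgraph H (complete_graph r)
        \<and> isomorphic_graphs G H \<and> (\<forall>e\<in>edges H. col e = c))"

definition ramsey_number :: "'a ugraph \<Rightarrow> nat" where
  "ramsey_number G = (LEAST r. arrows r G)"

text \<open>For a finite simple graph the minimum is attained, so the \<open>LEAST\<close> operator is never applied
  to an unsatisfiable predicate.\<close>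

lemma arrows_exists:
  assumes "simple_graph G"
  shows "\<exists>r. arrows r G"
proof -
  let ?n = "card (verts G)"
  have fin: "finite (verts G)" and edg: "edges G \<subseteq> [verts G]\<^bsup>2\<^esup>"
    using assms by (auto simp: simple_graph_def)
  obtain r where r: "\<And>(V::nat set) E. finite V \<Longrightarrow> card V \<ge> r \<Longrightarrow>
      \<exists>R\<subseteq>V. card R = ?n \<and> clique R E \<or> card R = ?n \<and> indep R E"
    using ramsey2[where m = ?n and n = ?n] by metis
  have "\<exists>H c. is_subgraph H (complete_graph r) \<and> isomorphic_graphs G H
           \<and> (\<forall>e\<in>edges H. col e = c)" for col :: "nat set \<Rightarrow> bool"
  proof -
    obtain R where R: "R \<subseteq> {..<r}" "card R = ?n" "clique R {e. col e} \<or> indep R {e. col e}"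
      using r[of "{..<r}" "{e. col e}"] by auto
    have finR: "finite R" using R(1) finite_subset by blast
    obtain f where f: "bij_betw f (verts G) R"
      using finite_same_card_bij[OF fin finR] R(2) by auto
    define H where "H = \<lparr>verts = R, edges = (\<lambda>e. f ` e) ` edges G\<rparr>"
    have nE: "e \<in> [R]\<^bsup>2\<^esup>" if "e \<in> edges H" for e
    proof -
      have "e \<in> (\<lambda>e. f ` e) ` edges G" using that by (simp add: H_def)
      then obtain d where d: "d \<in> edges G" "e = f ` d" by blast
      have dn: "d \<subseteq> verts G" "finite d" "card d = 2" using d(1) edg by (auto simp: nsets_def)
      have "card e = 2"
        using dn d(2) f card_image inj_on_subset by (metis bij_betw_def)
      moreover have "e \<subseteq> R" using dn(1) d(2) f by (auto simp: bij_betw_def)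
      ultimately show ?thesis using dn d(2) by (simp add: nsets_def)
    qed
    have sub: "is_subgraph H (complete_graph r)"
      using nE finR R(1) nsets_mono[OF R(1)]
      by (auto simp: is_subgraph_def simple_graph_def complete_graph_def H_def)
    have iso: "isomorphic_graphs G H" using f by (auto simp: isomorphic_graphs_def H_def)
    have "(\<forall>e\<in>edges H. col e = True) \<or> (\<forall>e\<in>edges H. col e = False)"
    proof -
      have pair: "\<exists>x y. x \<in> R \<and> y \<in> R \<and> x \<noteq> y \<and> e = {x, y}" if "e \<in> edges H" for e
        using nE[OF that] by (auto simp: nsets_def card_2_iff)
      from R(3) show ?thesis
        unfolding clique_def indep_def using pair by (metis mem_Collect_eq)
    qed
    with sub iso show ?thesis by blast
  qed
  then show ?thesis unfolding arrows_def by blast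
qed

datatype cat_vertex = Spine nat | Leaf nat nat

text \<open>\<open>Leaf i j\<close> is the \<open>j\<close>-th of the \<open>n i\<close> leaves attached to the spine vertex \<open>Spine i\<close>;
  all indices start at 1.\<close>

definition caterpillar :: "nat \<Rightarrow> (nat \<Rightarrow> nat) \<Rightarrow> cat_vertex ugraph" where
  "caterpillar k n =
     \<lparr>verts = {Spine i | i. i \<in> {1..k}} \<union> {Leaf i j | i j. i \<in> {1..k} \<and> j \<in> {1..n i}},
      edges = {{Spine i, Spine (i + 1)} | i. i \<in> {1..<k}}
            \<union> {{Spine i, Leaf i j} | i j. i \<in> {1..k} \<and> j \<in> {1..n i}}\<rparr>"

lemma simple_graph_caterpillar: "simple_graph (caterpillar k n)"
proof -
  have "verts (caterpillar k n) = Spine ` {1..k} \<union> (\<Union>i\<in>{1..k}. Leaf i ` {1..n i})"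
    by (auto simp: caterpillar_def)
  then have "finite (verts (caterpillar k n))" by simp
  moreover have "edges (caterpillar k n) \<subseteq> [verts (caterpillar k n)]\<^bsup>2\<^esup>"
    by (auto simp: caterpillar_def nsets_def card_insert_if)
  ultimately show ?thesis by (simp add: simple_graph_def)
qed

end

theory Submission
  imports Defs
begin

text \<open>The bound is Burr's general lower bound for the Ramsey number of a connected bipartite graph
  \<open>G\<close>, specialised to caterpillars. Let \<open>X\<close> and \<open>Y\<close> be the two classes of \<open>G\<close>, and let
  \<open>m = min |X| |Y|\<close>. Split the vertices of a complete graph on at most \<open>|V| + m - 2\<close> vertices into a
  set \<open>A\<close> of at most \<open>|V| - 1\<close> vertices and a remainder \<open>B\<close> of at most \<open>m - 1\<close> vertices. Colour an
  edge red if it stays inside \<open>A\<close> or inside \<open>B\<close>, and blue if it crosses. A red copy of \<open>G\<close> is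
  connected, so it lies inside \<open>A\<close> or inside \<open>B\<close>, and both are too small. In a blue copy every edge
  crosses between \<open>A\<close> and \<open>B\<close>; since a connected graph has only one bipartition, \<open>A\<close> and \<open>B\<close> cut the
  copy into its two classes, and \<open>B\<close> is too small to hold either of them. This is
  \<open>not_arrows_connected_bipartite\<close>.

  A caterpillar is connected, and one of its classes consists of the even spine vertices and the
  leaves attached to odd spine vertices. The sizes of this class and of the
  other one are \<open>m\<^sub>1\<close> and \<open>m\<^sub>2\<close>.\<close>

section \<open>A lower bound for connected bipartite graphs\<close>

text \<open>Connectedness is expressed by cuts rather than by paths: both colours of the colouring below
  come with a cut of the graph, to which this form applies at once.\<close>

definition connected_graph :: "'a ugraph \<Rightarrow> bool" where
  "connected_graph G \<longleftrightarrow>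
     (\<forall>S. (\<forall>e\<in>edges G. e \<subseteq> S \<or> e \<inter> S = {}) \<longrightarrow> verts G \<subseteq> S \<or> verts G \<inter> S = {})"

definition bipartition_class :: "'a set \<Rightarrow> 'a ugraph \<Rightarrow> bool" where
  "bipartition_class X G \<longleftrightarrow>
     X \<subseteq> verts G \<and> (\<forall>e\<in>edges G. \<exists>u v. e = {u, v} \<and> u \<in> X \<and> v \<in> verts G - X)"

text \<open>If every edge crosses \<open>X\<close> and every edge crosses \<open>S\<close>, then the set where \<open>X\<close> and \<open>S\<close> agree is
  not cut by any edge, so it contains all vertices or none.\<close>

lemma bipartition_unique:
  assumes conn: "connected_graph G"
    and bip: "bipartition_class X G"
    and cross: "\<And>e. e \<in> edges G \<Longrightarrow> \<not> e \<subseteq> S \<and> e \<inter> S \<noteq> {}"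
  shows "verts G \<inter> S = X \<or> verts G \<inter> S = verts G - X"
proof -
  let ?T = "{v. v \<in> X \<longleftrightarrow> v \<in> S}"
  have "e \<subseteq> ?T \<or> e \<inter> ?T = {}" if e: "e \<in> edges G" for e
  proof -
    obtain u v where "e = {u, v}" "u \<in> X" "v \<notin> X"
      using bip e by (auto simp: bipartition_class_def)
    with cross[OF e] show ?thesis by auto
  qed
  then have "verts G \<subseteq> ?T \<or> verts G \<inter> ?T = {}"
    using conn unfolding connected_graph_def by blast
  moreover have "X \<subseteq> verts G"
    using bip by (simp add: bipartition_class_def)
  ultimately show ?thesis by blast
qed

text \<open>Here \<open>A\<close> is an initial segment of the vertices and \<open>B\<close> is the rest. In either colour the
  preimages of \<open>A\<close> and \<open>B\<close> under the embedding of \<open>G\<close> form a cut of \<open>G\<close>, which connectedness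
  makes trivial for red and equal to the bipartition for blue.\<close>

theorem not_arrows_connected_bipartite:
  assumes fin: "finite (verts G)"
    and conn: "connected_graph G"
    and bip: "bipartition_class X G"
    and small: "r + 1 < card (verts G) + min (card X) (card (verts G - X))"
  shows "\<not> arrows r G"
proof
  assume "arrows r G"
  define A where "A = {..<card (verts G) - 1}"
  define col where "col e \<longleftrightarrow> e \<subseteq> A \<or> e \<inter> A = {}" for e
  obtain H c where sub: "is_subgraph H (complete_graph r)"
    and iso: "isomorphic_graphs G H" and mono: "\<And>e. e \<in> edges H \<Longrightarrow> col e = c"
    using \<open>arrows r G\<close> unfolding arrows_def by metis
  obtain f where f: "bij_betw f (verts G) (verts H)" and E: "edges H = (\<lambda>e. f ` e) ` edges G"
    using iso unfolding isomorphic_graphs_def by blast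
  have inj: "inj_on f (verts G)"
    using f by (rule bij_betw_imp_inj_on)
  have image: "f ` verts G \<subseteq> {..<r}"
    using f sub by (auto simp: bij_betw_def is_subgraph_def complete_graph_def)
  have card_le: "card Y \<le> card Z" if "f ` Y \<subseteq> Z" "finite Z" "Y \<subseteq> verts G" for Y and Z
    using card_inj_on_le[OF inj_on_subset[OF inj that(3)]] that by blast
  (* The copy of G has room only if r is at least |V|, so the size r - (|V| - 1) of B below is a
     true difference and not a truncated one. *)
  have V_le: "card (verts G) \<le> r"
    using card_le[OF image] by simp
  have X_le: "card X \<le> card (verts G)"
    using bip fin by (auto simp: bipartition_class_def intro: card_mono)
  let ?S = "f -` A"
  have B: "f ` (verts G - ?S) \<subseteq> {card (verts G) - 1..<r}"
    using image by (auto simp: A_def)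
  have col_iff: "c \<longleftrightarrow> e \<subseteq> ?S \<or> e \<inter> ?S = {}" if "e \<in> edges G" for e
    using mono[of "f ` e"] that unfolding E col_def by auto
  show False
  proof (cases c)
    case True
    then have "verts G \<subseteq> ?S \<or> verts G \<inter> ?S = {}"
      using conn col_iff unfolding connected_graph_def by blast
    then show False
    proof
      assume "verts G \<subseteq> ?S"
      then have "card (verts G) \<le> card A"
        by (intro card_le) (auto simp: A_def)
      then show False
        using small X_le by (simp add: A_def)
    next
      assume "verts G \<inter> ?S = {}"
      then have "verts G - ?S = verts G" by blast
      then have "card (verts G) \<le> r - (card (verts G) - 1)"
        using card_le[OF B] by simp
      then show False
        using small X_le V_le by linarith
    qed
  next
    case False
    then have "verts G \<inter> ?S = X \<or> verts G \<inter> ?S = verts G - X"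
      by (intro bipartition_unique[OF conn bip]) (use col_iff in blast)
    then have "verts G - ?S = verts G - X \<or> verts G - ?S = X"
      using bip by (auto simp: bipartition_class_def)
    then have "min (card X) (card (verts G - X)) \<le> card (verts G - ?S)"
      by auto
    also have "\<dots> \<le> r - (card (verts G) - 1)"
      using card_le[OF B] by simp
    finally show False
      using small V_le by linarith
  qed
qed

section \<open>Caterpillars\<close>

text \<open>The vertex set of a caterpillar and both of its classes are of this form.\<close>

definition spine_leaf_set :: "(nat \<Rightarrow> nat) \<Rightarrow> nat set \<Rightarrow> nat set \<Rightarrow> cat_vertex set" where
  "spine_leaf_set n P Q = Spine ` P \<union> (\<Union>i\<in>Q. Leaf i ` {1..n i})"

lemma mem_spine_leaf_set [simp]:
  "Spine i \<in> spine_leaf_set n P Q \<longleftrightarrow> i \<in> P"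
  "Leaf i j \<in> spine_leaf_set n P Q \<longleftrightarrow> i \<in> Q \<and> j \<in> {1..n i}"
  by (auto simp: spine_leaf_set_def image_iff)

lemma card_spine_leaf_set:
  assumes "finite P" "finite Q"
  shows "card (spine_leaf_set n P Q) = card P + sum n Q"
proof -
  have "card (\<Union>i\<in>Q. Leaf i ` {1..n i}) = (\<Sum>i\<in>Q. card (Leaf i ` {1..n i}))"
    using assms by (intro card_UN_disjoint) auto
  also have "\<dots> = sum n Q"
    by (intro sum.cong) (auto simp: card_image inj_on_def)
  finally have "card (\<Union>i\<in>Q. Leaf i ` {1..n i}) = sum n Q" .
  moreover have "card (Spine ` P) = card P"
    by (simp add: card_image inj_on_def)
  ultimately show ?thesis
    unfolding spine_leaf_set_def using assms by (subst card_Un_disjoint) auto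
qed

lemma verts_caterpillar: "verts (caterpillar k n) = spine_leaf_set n {1..k} {1..k}"
  by (auto simp: caterpillar_def spine_leaf_set_def)

lemma connected_caterpillar: "connected_graph (caterpillar k n)"
  unfolding connected_graph_def
proof (intro allI impI)
  fix S
  assume S: "\<forall>e\<in>edges (caterpillar k n). e \<subseteq> S \<or> e \<inter> S = {}"
  have next_spine: "Spine (i + 1) \<in> S \<longleftrightarrow> Spine i \<in> S" if "i \<in> {1..<k}" for i
  proof -
    have "{Spine i, Spine (i + 1)} \<in> edges (caterpillar k n)"
      using that by (auto simp: caterpillar_def)
    from bspec[OF S this] show ?thesis by auto
  qed
  have leaf: "Leaf i j \<in> S \<longleftrightarrow> Spine i \<in> S" if "i \<in> {1..k}" "j \<in> {1..n i}" for i j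
  proof -
    have "{Spine i, Leaf i j} \<in> edges (caterpillar k n)"
      using that by (auto simp: caterpillar_def)
    from bspec[OF S this] show ?thesis by auto
  qed
  have spine: "Spine i \<in> S \<longleftrightarrow> Spine 1 \<in> S" if "1 \<le> i" "i \<le> k" for i
    using that
  proof (induction i rule: dec_induct)
    case (step i)
    then show ?case using next_spine[of i] by simp
  qed simp
  have all: "v \<in> S \<longleftrightarrow> Spine 1 \<in> S" if "v \<in> verts (caterpillar k n)" for v
  proof (cases v)
    case (Spine i)
    then show ?thesis using that spine[of i] by (simp add: verts_caterpillar)
  next
    case (Leaf i j)
    then show ?thesis using that leaf[of i j] spine[of i] by (simp add: verts_caterpillar)
  qed
  then show "verts (caterpillar k n) \<subseteq> S \<or> verts (caterpillar k n) \<inter> S = {}"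
    by blast
qed

text \<open>A leaf lies in the class opposite to its spine vertex, so the even spine vertices go together
  with the leaves of the odd ones.\<close>

definition even_class :: "nat \<Rightarrow> (nat \<Rightarrow> nat) \<Rightarrow> cat_vertex set" where
  "even_class k n = spine_leaf_set n {i\<in>{1..k}. even i} {i\<in>{1..k}. odd i}"

lemma verts_minus_even_class:
  "verts (caterpillar k n) - even_class k n =
     spine_leaf_set n {i\<in>{1..k}. odd i} {i\<in>{1..k}. even i}"
proof (rule set_eqI)
  fix v
  show "v \<in> verts (caterpillar k n) - even_class k n \<longleftrightarrow>
      v \<in> spine_leaf_set n {i\<in>{1..k}. odd i} {i\<in>{1..k}. even i}"
    by (cases v) (auto simp: verts_caterpillar even_class_def)
qed

lemma bipartition_class_even_class: "bipartition_class (even_class k n) (caterpillar k n)"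
  unfolding bipartition_class_def verts_minus_even_class
proof (intro conjI ballI)
  show "even_class k n \<subseteq> verts (caterpillar k n)"
    by (auto simp: verts_caterpillar even_class_def spine_leaf_set_def)
  fix e
  assume "e \<in> edges (caterpillar k n)"
  then consider i where "e = {Spine i, Spine (i + 1)}" "i \<in> {1..<k}"
    | i j where "e = {Spine i, Leaf i j}" "i \<in> {1..k}" "j \<in> {1..n i}"
    by (auto simp: caterpillar_def)
  then show "\<exists>u v. e = {u, v} \<and> u \<in> even_class k n \<and>
      v \<in> spine_leaf_set n {i\<in>{1..k}. odd i} {i\<in>{1..k}. even i}"
  proof cases
    case (1 i)
    show ?thesis
    proof (cases "even i")
      case True
      with 1 show ?thesis
        by (intro exI[of _ "Spine i"] exI[of _ "Spine (i + 1)"]) (simp add: even_class_def)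
    next
      case False
      with 1 show ?thesis
        by (intro exI[of _ "Spine (i + 1)"] exI[of _ "Spine i"])
          (simp add: even_class_def insert_commute)
    qed
  next
    case (2 i j)
    show ?thesis
    proof (cases "even i")
      case True
      with 2 show ?thesis
        by (intro exI[of _ "Spine i"] exI[of _ "Leaf i j"]) (simp add: even_class_def)
    next
      case False
      with 2 show ?thesis
        by (intro exI[of _ "Leaf i j"] exI[of _ "Spine i"])
          (simp add: even_class_def insert_commute)
    qed
  qed
qed

section \<open>Counting the two classes\<close>

lemma nat_floor_half: "nat \<lfloor>real k / 2\<rfloor> = k div 2"
  using floor_divide_of_nat_eq[of k 2, where ?'a = real] by simp

lemma nat_ceiling_half: "nat \<lceil>real k / 2\<rceil> = (k + 1) div 2"
proof -
  have "\<lceil>real k / 2\<rceil> = int ((k + 1) div 2)"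
    by (cases "even k") (auto elim!: evenE oddE intro: ceiling_unique)
  then show ?thesis by simp
qed

lemma evens_image: "{i\<in>{1..k::nat}. even i} = (\<lambda>i. 2 * i) ` {1..k div 2}"
  by (auto elim!: evenE)

lemma odds_image: "{i\<in>{1..k::nat}. odd i} = (\<lambda>i. 2 * i - 1) ` {1..(k + 1) div 2}"
proof (intro equalityI subsetI)
  fix i assume "i \<in> {i\<in>{1..k}. odd i}"
  then show "i \<in> (\<lambda>i. 2 * i - 1) ` {1..(k + 1) div 2}"
    by (intro image_eqI[where x = "(i + 1) div 2"]) (auto elim!: oddE)
qed auto

lemma inj_on_odds: "inj_on (\<lambda>i::nat. 2 * i - 1) {1..b}"
  by (auto simp: inj_on_def)

lemma inj_on_evens: "inj_on (\<lambda>i::nat. 2 * i) {1..b}"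
  by (auto simp: inj_on_def)

lemma card_even_class:
  "card (even_class k n) = (\<Sum>i = 1..(k + 1) div 2. n (2 * i - 1)) + k div 2"
proof -
  have "card (even_class k n) = card {i\<in>{1..k}. even i} + sum n {i\<in>{1..k}. odd i}"
    by (simp add: even_class_def card_spine_leaf_set)
  then show ?thesis
    unfolding evens_image odds_image sum.reindex[OF inj_on_odds] card_image[OF inj_on_evens]
    by simp
qed

lemma card_verts_minus_even_class:
  "card (verts (caterpillar k n) - even_class k n) =
     (\<Sum>i = 1..k div 2. n (2 * i)) + (k + 1) div 2"
proof -
  have "card (verts (caterpillar k n) - even_class k n) =
      card {i\<in>{1..k}. odd i} + sum n {i\<in>{1..k}. even i}"
    by (simp add: verts_minus_even_class card_spine_leaf_set)
  then show ?thesis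
    unfolding evens_image odds_image sum.reindex[OF inj_on_evens] card_image[OF inj_on_odds]
    by simp
qed

theorem proposition2p2:
  fixes k :: nat and n :: "nat \<Rightarrow> nat" and m1 m2 m :: nat
  assumes "k \<ge> 2"
    and "n 1 \<noteq> 0" and "n k \<noteq> 0"
    and "m1 = (\<Sum>i = 1..nat \<lceil>real k / 2\<rceil>. n (2 * i - 1)) + nat \<lfloor>real k / 2\<rfloor>"
    and "m2 = (\<Sum>i = 1..nat \<lfloor>real k / 2\<rfloor>. n (2 * i)) + nat \<lceil>real k / 2\<rceil>"
    and "m = min m1 m2"
  shows "ramsey_number (caterpillar k n) \<ge> (\<Sum>i = 1..k. n i) + k + m - 1
    \<and> (\<Sum>i = 1..k. n i) + k + m - 1 = card (verts (caterpillar k n)) + m - 1"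
proof
  let ?G = "caterpillar k n"
  have V: "card (verts ?G) = (\<Sum>i = 1..k. n i) + k"
    by (simp add: verts_caterpillar card_spine_leaf_set)
  then show "(\<Sum>i = 1..k. n i) + k + m - 1 = card (verts ?G) + m - 1"
    by simp
  have m: "m = min (card (even_class k n)) (card (verts ?G - even_class k n))"
    unfolding card_even_class card_verts_minus_even_class
    using assms(4-6) unfolding nat_floor_half nat_ceiling_half by simp
  have "finite (verts ?G)"
    using simple_graph_caterpillar by (simp add: simple_graph_def)
  then have not_arrows: "\<not> arrows r ?G" if "r + 1 < card (verts ?G) + m" for r
    using not_arrows_connected_bipartite[OF _ connected_caterpillar bipartition_class_even_class]
      that m by simp
  have "arrows (ramsey_number ?G) ?G"
    unfolding ramsey_number_def using arrows_exists[OF simple_graph_caterpillar] by (rule LeastI_ex)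
  then have "\<not> ramsey_number ?G + 1 < card (verts ?G) + m"
    using not_arrows by blast
  with V show "(\<Sum>i = 1..k. n i) + k + m - 1 \<le> ramsey_number ?G"
    by linarith
qed

end
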